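(* Let $\sigma>0$, let $y\in\mathbb{R}^{m+1}$ satisfy $Q-\mathcal{A}^\top y\succ0$ and $y_{kl}\le0$ for all index pairs $kl$, let $ij$ ($1\le i\le n$, $l_i\le j\le u_i$) be a coordinate, and let $s_0(s)$ and $g_{ij}'(s)$ be the functions defined in the context. (i) Suppose $g_{ij}'(0)>0$ and $y_{ij}<0$. If $g_{ij}'$ has at least one positive root, then for the smallest positive root $s^+$, either the point $y+s_0(s^+)e_0+s^+e_{ij}$ is dual feasible and $g_{ij}'(s^+)=0$, or $y_{ij}+s^+>0$ and $g_{ij}'(-y_{ij})>0$. Otherwise (if there is no positive root) $g_{ij}'(-y_{ij})>0$. (ii) Suppose $g_{ij}'(0)<0$. Then $g_{ij}'$ has at least one negative root, and for the biggest negative root $s^-$, the point $y+s_0(s^-)e_0+s^-e_{ij}$ is dual feasible and $g_{ij}'(s^-)=0$.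
   Context: Let $n\ge 1$, let $\hat Q\in\mathbb{R}^{n\times n}$ be symmetric (not necessarily positive semidefinite), $\hat l\in\mathbb{R}^n$, $\hat c\in\mathbb{R}$. For $i=1,\dots,n$ let $l_i,u_i\in\mathbb{Z}$ with $l_i<u_i$, $n_i=u_i-l_i+1$, and $m=\sum_{i=1}^n n_i$. Let $\beta=(\beta_{ij})_{1\le i\le n,\ l_i\le j\le u_i}\in\mathbb{R}^m$ be arbitrary. $S_{n+1}$ denotes the real symmetric $(n+1)\times(n+1)$ matrices, with rows and columns indexed by $0,1,\dots,n$, and $\langle\cdot,\cdot\rangle$ is the trace (Frobenius) inner product on matrices and the standard inner product on vectors. Put $Q=\begin{pmatrix}\hat c & \frac12\hat l^\top\\ \frac12\hat l & \hat Q\end{pmatrix}\in S_{n+1}$ and $A_0$ the matrix in $S_{n+1}$ whose only nonzero entry is $(A_0)_{00}=1$. For $1\le i\le n$ and $l_i\le j\le u_i$ let $A_{ij}\in S_{n+1}$ be the matrix whose only possibly nonzero entries are: for $j=u_i$: $(A_{iu_i})_{00}=\beta_{iu_i}+l_iu_i$, $(A_{iu_i})_{0i}=(A_{iu_i})_{i0}=-\frac12(l_i+u_i)$, $(A_{iu_i})_{ii}=1$; for $l_i\le j\le u_i-1$: $(A_{ij})_{00}=\beta_{ij}-j(j+1)$, $(A_{ij})_{0i}=(A_{ij})_{i0}=j+\frac12$, $(A_{ij})_{ii}=-1$. Vectors $y\in\mathbb{R}^{m+1}$ have coordinates $y_0$ and $y_{ij}$ ($1\le i\le n$, $l_i\le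 j\le u_i$); $e_0,e_{ij}\in\mathbb{R}^{m+1}$ denote the corresponding unit vectors. Put $\mathcal{A}^\top y=y_0A_0+\sum_{i,j}y_{ij}A_{ij}$, and let $b\in\mathbb{R}^{m+1}$ be given by $b_0=1$, $b_{ij}=\beta_{ij}$. A vector $y$ is dual feasible if $Q-\mathcal{A}^\top y\succeq0$ and $y_{ij}\le0$ for all $i,j$ ($y_0$ is free). The barrier function is $f(y;\sigma)=\langle b,y\rangle+\sigma\log\det(Q-\mathcal{A}^\top y)$ on $\{y:Q-\mathcal{A}^\top y\succ0\}$. For $y$ with $Q-\mathcal{A}^\top y\succ0$ put $W=(Q-\mathcal{A}^\top y)^{-1}$, $W(s)=(W^{-1}-sA_{ij})^{-1}$, let $w(s)_{00}$ be the $(0,0)$ entry of $W(s)$, and \[ s_0(s)=\frac{1}{w(s)_{00}}-\sigma . \] Let $g_{ij}(s)=f(y+s_0(s)e_0+se_{ij};\sigma)$ on the set of $s$ with $Q-\mathcal{A}^\top(y+s_0(s)e_0+se_{ij})\succ0$. Its derivative is \[ g_{ij}'(s)=s_0'(s)+\beta_{ij}-\sigma\big\langle s_0'(s)A_0+A_{ij},\,(W^{-1}-s_0(s)A_0-sA_{ij})^{-1}\big\rangle . \] Both $s_0$ and $g_{ij}'$ are regarded as rational functions of $s$ given by these expressions (with removable singularities filled in); a root of $g_{ij}'$ is a real number in its domain at which it vanishes. *)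

theory Defs
  imports "HOL-Analysis.Analysis"
begin

text \<open>
  Rows and columns \<open>0, 1, ..., n\<close> of a matrix in \<open>S\<^sub>n\<^sub>+\<^sub>1\<close> are indexed by \<open>'n option\<close>, where
  \<open>None\<close> is the index \<open>0\<close> and \<open>n = CARD('n)\<close>.
  In the same way the coordinates of a dual vector are indexed by \<open>('n \<times> int) option\<close>:
  \<open>None\<close> is the coordinate \<open>0\<close> and \<open>Some (i, j)\<close> is the coordinate \<open>ij\<close>.
  Only the coordinates \<open>Some (i, j)\<close> with \<open>l i \<le> j \<le> u i\<close> belong to the vector, and nothing
  below depends on the values at other \<open>Some (i, j)\<close>.
\<close>

type_synonym 'n smat = "real ^ 'n option ^ 'n option"
type_synonym 'n dvec = "('n \<times> int) option \<Rightarrow> real"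

definition pos_semidef :: "real ^ 'k ^ 'k \<Rightarrow> bool" where
  "pos_semidef M \<longleftrightarrow> transpose M = M \<and> (\<forall>x. 0 \<le> x \<bullet> (M *v x))"

definition pos_def :: "real ^ 'k ^ 'k \<Rightarrow> bool" where
  "pos_def M \<longleftrightarrow> transpose M = M \<and> (\<forall>x. x \<noteq> 0 \<longrightarrow> 0 < x \<bullet> (M *v x))"

definition Qmat :: "real \<Rightarrow> real ^ 'n \<Rightarrow> real ^ 'n ^ 'n \<Rightarrow> 'n::finite smat" where
  "Qmat c q Q = (\<chi> r k. case (r, k) of
       (None, None) \<Rightarrow> c
     | (None, Some i) \<Rightarrow> q $ i / 2
     | (Some i, None) \<Rightarrow> q $ i / 2
     | (Some i, Some j) \<Rightarrow> Q $ i $ j)"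

definition A0 :: "'n::finite smat" where
  "A0 = (\<chi> r k. if r = None \<and> k = None then 1 else 0)"

definition arrow :: "'n \<Rightarrow> real \<Rightarrow> real \<Rightarrow> real \<Rightarrow> 'n::finite smat" where
  "arrow i a b d = (\<chi> r k.
       if r = None \<and> k = None then a
       else if r = None \<and> k = Some i \<or> r = Some i \<and> k = None then b
       else if r = Some i \<and> k = Some i then d
       else 0)"

definition Amat :: "('n \<Rightarrow> int) \<Rightarrow> ('n \<Rightarrow> int) \<Rightarrow> ('n \<Rightarrow> int \<Rightarrow> real) \<Rightarrow> 'n \<Rightarrow> int \<Rightarrow> 'n::finite smat" where
  "Amat l u \<beta> i j =
     (if j = u i
      then arrow i (\<beta> i j + real_of_int (l i * u i)) (- (real_of_int (l i + u i) / 2)) 1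
      else arrow i (\<beta> i j - real_of_int (j * (j + 1))) (real_of_int j + 1 / 2) (- 1))"

definition unit_vec :: "('n \<times> int) option \<Rightarrow> 'n dvec" where
  "unit_vec c = (\<lambda>d. if d = c then 1 else 0)"

definition adjoint_map ::
  "('n \<Rightarrow> int) \<Rightarrow> ('n \<Rightarrow> int) \<Rightarrow> ('n \<Rightarrow> int \<Rightarrow> real) \<Rightarrow> 'n dvec \<Rightarrow> 'n::finite smat" where
  "adjoint_map l u \<beta> y =
     y None *\<^sub>R A0 + (\<Sum>i\<in>UNIV. \<Sum>j\<in>{l i..u i}. y (Some (i, j)) *\<^sub>R Amat l u \<beta> i j)"

definition slack ::
  "'n smat \<Rightarrow> ('n \<Rightarrow> int) \<Rightarrow> ('n \<Rightarrow> int) \<Rightarrow> ('n \<Rightarrow> int \<Rightarrow> real) \<Rightarrow> 'n dvec \<Rightarrow> 'n::finite smat" where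
  "slack Q l u \<beta> y = Q - adjoint_map l u \<beta> y"

definition nonpos_coords :: "('n \<Rightarrow> int) \<Rightarrow> ('n \<Rightarrow> int) \<Rightarrow> 'n dvec \<Rightarrow> bool" where
  "nonpos_coords l u y \<longleftrightarrow> (\<forall>i. \<forall>j\<in>{l i..u i}. y (Some (i, j)) \<le> 0)"

definition dual_feasible ::
  "'n::finite smat \<Rightarrow> ('n \<Rightarrow> int) \<Rightarrow> ('n \<Rightarrow> int) \<Rightarrow> ('n \<Rightarrow> int \<Rightarrow> real) \<Rightarrow> 'n dvec \<Rightarrow> bool" where
  "dual_feasible Q l u \<beta> y \<longleftrightarrow> pos_semidef (slack Q l u \<beta> y) \<and> nonpos_coords l u y"

text \<open>
  Below, a rational function of one real variable is given by an expression \<open>h\<close> that is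
  meaningful at all but finitely many points. With removable singularities filled in, \<open>s\<close> lies
  in its domain (is not a pole) iff \<open>h\<close> has a finite limit at \<open>s\<close>, and its value there is that
  limit. The limit is punctured, so the arbitrary values that \<open>matrix_inv\<close>, division by zero and
  \<open>deriv\<close> give to \<open>h\<close> at the finitely many exceptional points play no role. Outside
  \<open>filled_dom h\<close> the value \<open>filled h s\<close> is meaningless.
\<close>

definition filled_dom :: "(real \<Rightarrow> real) \<Rightarrow> real set" where
  "filled_dom h = {s. \<exists>L. (h \<longlongrightarrow> L) (at s)}"

definition filled :: "(real \<Rightarrow> real) \<Rightarrow> real \<Rightarrow> real" where
  "filled h s = Lim (at s) h"

text \<open>In \<open>Wmat\<close> and \<open>dg_expr\<close>, \<open>slack Q l u \<beta> y\<close> is \<open>W\<^sup>-\<^sup>1\<close>.\<close>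

definition Wmat ::
  "'n smat \<Rightarrow> ('n \<Rightarrow> int) \<Rightarrow> ('n \<Rightarrow> int) \<Rightarrow> ('n \<Rightarrow> int \<Rightarrow> real) \<Rightarrow> 'n dvec \<Rightarrow> 'n \<Rightarrow> int
     \<Rightarrow> real \<Rightarrow> 'n::finite smat" where
  "Wmat Q l u \<beta> y i j s = matrix_inv (slack Q l u \<beta> y - s *\<^sub>R Amat l u \<beta> i j)"

definition s0_expr ::
  "'n::finite smat \<Rightarrow> ('n \<Rightarrow> int) \<Rightarrow> ('n \<Rightarrow> int) \<Rightarrow> ('n \<Rightarrow> int \<Rightarrow> real) \<Rightarrow> real \<Rightarrow> 'n dvec \<Rightarrow> 'n \<Rightarrow> int
     \<Rightarrow> real \<Rightarrow> real" where
  "s0_expr Q l u \<beta> \<sigma> y i j s = 1 / Wmat Q l u \<beta> y i j s $ None $ None - \<sigma>"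

definition s0_dom ::
  "'n::finite smat \<Rightarrow> ('n \<Rightarrow> int) \<Rightarrow> ('n \<Rightarrow> int) \<Rightarrow> ('n \<Rightarrow> int \<Rightarrow> real) \<Rightarrow> real \<Rightarrow> 'n dvec \<Rightarrow> 'n \<Rightarrow> int
     \<Rightarrow> real set" where
  "s0_dom Q l u \<beta> \<sigma> y i j = filled_dom (s0_expr Q l u \<beta> \<sigma> y i j)"

definition s0 ::
  "'n::finite smat \<Rightarrow> ('n \<Rightarrow> int) \<Rightarrow> ('n \<Rightarrow> int) \<Rightarrow> ('n \<Rightarrow> int \<Rightarrow> real) \<Rightarrow> real \<Rightarrow> 'n dvec \<Rightarrow> 'n \<Rightarrow> int
     \<Rightarrow> real \<Rightarrow> real" where
  "s0 Q l u \<beta> \<sigma> y i j = filled (s0_expr Q l u \<beta> \<sigma> y i j)"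

definition dg_expr ::
  "'n::finite smat \<Rightarrow> ('n \<Rightarrow> int) \<Rightarrow> ('n \<Rightarrow> int) \<Rightarrow> ('n \<Rightarrow> int \<Rightarrow> real) \<Rightarrow> real \<Rightarrow> 'n dvec \<Rightarrow> 'n \<Rightarrow> int
     \<Rightarrow> real \<Rightarrow> real" where
  "dg_expr Q l u \<beta> \<sigma> y i j s =
     deriv (s0 Q l u \<beta> \<sigma> y i j) s + \<beta> i j
     - \<sigma> * ((deriv (s0 Q l u \<beta> \<sigma> y i j) s *\<^sub>R A0 + Amat l u \<beta> i j)
            \<bullet> matrix_inv (slack Q l u \<beta> y - s0 Q l u \<beta> \<sigma> y i j s *\<^sub>R A0 - s *\<^sub>R Amat l u \<beta> i j))"

definition dg_dom ::
  "'n::finite smat \<Rightarrow> ('n \<Rightarrow> int) \<Rightarrow> ('n \<Rightarrow> int) \<Rightarrow> ('n \<Rightarrow> int \<Rightarrow> real) \<Rightarrow> real \<Rightarrow> 'n dvec \<Rightarrow> 'n \<Rightarrow> int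
     \<Rightarrow> real set" where
  "dg_dom Q l u \<beta> \<sigma> y i j = filled_dom (dg_expr Q l u \<beta> \<sigma> y i j)"

definition dg ::
  "'n::finite smat \<Rightarrow> ('n \<Rightarrow> int) \<Rightarrow> ('n \<Rightarrow> int) \<Rightarrow> ('n \<Rightarrow> int \<Rightarrow> real) \<Rightarrow> real \<Rightarrow> 'n dvec \<Rightarrow> 'n \<Rightarrow> int
     \<Rightarrow> real \<Rightarrow> real" where
  "dg Q l u \<beta> \<sigma> y i j = filled (dg_expr Q l u \<beta> \<sigma> y i j)"

definition dg_roots ::
  "'n::finite smat \<Rightarrow> ('n \<Rightarrow> int) \<Rightarrow> ('n \<Rightarrow> int) \<Rightarrow> ('n \<Rightarrow> int \<Rightarrow> real) \<Rightarrow> real \<Rightarrow> 'n dvec \<Rightarrow> 'n \<Rightarrow> int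
     \<Rightarrow> real set" where
  "dg_roots Q l u \<beta> \<sigma> y i j = {s \<in> dg_dom Q l u \<beta> \<sigma> y i j. dg Q l u \<beta> \<sigma> y i j s = 0}"

definition moved_point ::
  "'n::finite smat \<Rightarrow> ('n \<Rightarrow> int) \<Rightarrow> ('n \<Rightarrow> int) \<Rightarrow> ('n \<Rightarrow> int \<Rightarrow> real) \<Rightarrow> real \<Rightarrow> 'n dvec \<Rightarrow> 'n \<Rightarrow> int
     \<Rightarrow> real \<Rightarrow> 'n dvec" where
  "moved_point Q l u \<beta> \<sigma> y i j s =
     (\<lambda>c. y c + s0 Q l u \<beta> \<sigma> y i j s * unit_vec None c + s * unit_vec (Some (i, j)) c)"

end

theory Submission imports Defs begin

text \<open>
  The matrix \<open>A\<^sub>i\<^sub>j\<close> only touches the rows and columns \<open>0\<close> and \<open>i\<close>, so everything that happens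
  along the curve \<open>s \<mapsto> y + s\<^sub>0(s) e\<^sub>0 + s e\<^sub>i\<^sub>j\<close> can be computed in closed form. Let \<open>a\<close>, \<open>b\<close>, \<open>d\<close>
  be the entries of \<open>A\<^sub>i\<^sub>j\<close> at \<open>00\<close>, \<open>0i\<close>, \<open>ii\<close>, and let \<open>p > 0\<close> be the entry at \<open>ii\<close> of the
  inverse of the block of \<open>W\<^sup>-\<^sup>1\<close> with indices \<open>1, ..., n\<close>. Moving by \<open>s\<close> multiplies the
  determinant of that block by \<open>t(s) = 1 - s d p\<close>, and the Schur complement of the block is
  \<open>1 / w(s)\<^sub>0\<^sub>0\<close>, a rational function \<open>\<phi>(s)\<close> whose only possible pole is the zero of \<open>t\<close>. The
  choice \<open>s\<^sub>0 = \<phi> - \<sigma>\<close> makes the Schur complement of the moved slack matrix constantly \<open>\<sigma>\<close>.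
  Hence the moved slack matrix is positive definite exactly for \<open>t(s) > 0\<close>, and its determinant
  is a constant times \<open>t(s)\<close>. With \<open>\<rho>\<close> as defined below this gives
    \<open>g'(s) = (\<beta>\<^sub>i\<^sub>j - a + b\<^sup>2 / d) - d \<rho>\<^sup>2 / t(s)\<^sup>2 - \<sigma> d p / t(s)\<close>.

  The constant term has the sign of \<open>d\<close>: after multiplication by \<open>d\<close> it is a quarter of the
  discriminant of the quadratic \<open>d X\<^sup>2 + 2 b X + a - \<beta>\<^sub>i\<^sub>j\<close>, which is \<open>(X - l\<^sub>i) (X - u\<^sub>i)\<close> or
  \<open>- (X - j) (X - j - 1)\<close> and has two distinct real roots. So \<open>g' / d\<close> is an increasing function
  of \<open>t > 0\<close> that runs from \<open>-\<infinity>\<close> to a positive limit, and \<open>g'\<close> is decreasing on the interval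
  \<open>t(s) > 0\<close>, which contains \<open>0\<close>; it has exactly one root \<open>S\<close> there, is positive to the left of
  \<open>S\<close> and negative to the right. If \<open>g'(0) > 0\<close> then \<open>S > 0\<close>; if \<open>g'(0) < 0\<close> then \<open>S < 0\<close>. In
  both cases \<open>S\<close> is the root closest to \<open>0\<close> on its side, since the interval between \<open>0\<close> and \<open>S\<close>
  stays in \<open>t > 0\<close>. Both parts follow; in particular a positive root always exists in part (i).

  The closed form is obtained without determinants or block matrices. Two vectors \<open>x\<close> and \<open>z\<close>,
  which \<open>W\<^sup>-\<^sup>1\<close> maps into the span of the unit vectors \<open>0\<close> and \<open>i\<close>, yield the four entries of
  the inverse that occur (\<open>matrix_inv_N\<close>) and diagonalise the quadratic form
  (\<open>pos_semidef_N\<close>). \<open>dg_expr_eq\<close> is the formula for \<open>g'\<close>, \<open>slope_sign\<close> its sign pattern,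
  and \<open>critical_point\<close> collects what the theorem needs.
\<close>

section \<open>Symmetric matrices and arrow matrices\<close>

lemma inner_symmetric_matrix:
  fixes N :: "real ^ 'k ^ 'k"
  assumes "transpose N = N"
  shows "v \<bullet> (N *v w) = w \<bullet> (N *v v)"
  by (metis assms dot_lmul_matrix inner_commute transpose_matrix_vector)

lemma invertible_if_trivial_kernel:
  fixes N :: "real ^ 'k ^ 'k"
  assumes "\<And>v. N *v v = 0 \<Longrightarrow> v = 0"
  shows "invertible N"
  using assms by (meson invertible_left_inverse matrix_left_invertible_ker)

lemma pos_def_invertible: "pos_def M \<Longrightarrow> invertible M"
  by (rule invertible_if_trivial_kernel) (metis inner_zero_right less_irrefl pos_def_def)

lemma matrix_inv_column:
  fixes N :: "real ^ 'k ^ 'k"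
  assumes "invertible N" and "N *v v = axis c 1"
  shows "matrix_inv N $ r $ c = v $ r"
proof -
  have "matrix_inv N ** N = mat 1"
    using assms(1) unfolding invertible_def matrix_inv_def by (rule someI2_ex) auto
  then have "matrix_inv N *v axis c 1 = v"
    by (metis assms(2) matrix_vector_mul_assoc matrix_vector_mul_lid)
  then show ?thesis
    by (simp add: matrix_vector_mult_basis column_def vec_eq_iff)
qed

lemma axis_matrix_vector_mult:
  fixes w :: "real ^ 'm"
  shows "axis k w *v v = (w \<bullet> v) *\<^sub>R (axis k 1 :: real ^ 'k)"
  by (simp add: vec_eq_iff matrix_vector_mul_component axis_def)

text \<open>
  Written as a sum of rows, an arrow matrix is evaluated by the library rules for inner products
  with \<^const>\<open>axis\<close>, both in matrix-vector products and in the trace inner product.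
\<close>

lemma arrow_axis:
  "arrow i a b d = axis None (axis None a + axis (Some i) b)
                 + axis (Some i) (axis None b + axis (Some i) d)"
  by (auto simp: arrow_def vec_eq_iff axis_def)

lemma arrow_mult_vec:
  "arrow i a b d *v v = (a * v $ None + b * v $ Some i) *\<^sub>R axis None 1
                      + (b * v $ None + d * v $ Some i) *\<^sub>R axis (Some i) 1"
  by (simp add: arrow_axis axis_matrix_vector_mult matrix_vector_mult_add_rdistrib
      inner_add_left inner_axis')

lemma arrow_inner:
  "arrow i a b d \<bullet> W = a * W $ None $ None + b * W $ None $ Some i
                     + b * W $ Some i $ None + d * W $ Some i $ Some i"
  by (simp add: arrow_axis inner_add_left inner_axis')

lemma scaleR_A0_plus_arrow: "\<tau> *\<^sub>R A0 + arrow i a b d = arrow i (\<tau> + a) b d"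
  by (auto simp: arrow_def A0_def vec_eq_iff)

lemma A0_arrow: "A0 = arrow i 1 0 0"
  by (auto simp: arrow_def A0_def vec_eq_iff)

lemma transpose_arrow: "transpose (arrow i a b d) = arrow i a b d"
  by (auto simp: arrow_def transpose_def vec_eq_iff)

lemma transpose_diff: "transpose (X - Y) = transpose X - transpose (Y :: real ^ 'k ^ 'l)"
  by (simp add: transpose_def vec_eq_iff)

lemma transpose_scaleR: "transpose (c *\<^sub>R X) = c *\<^sub>R transpose (X :: real ^ 'k ^ 'l)"
  by (simp add: transpose_def vec_eq_iff)

section \<open>The pencil of a positive definite matrix and an arrow matrix\<close>

text \<open>
  In block form let \<open>M\<close> have the entry \<open>m\<close> at \<open>00\<close>, the column \<open>q\<close> below it, and the block \<open>P\<close>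
  for the indices \<open>1, ..., n\<close>. Then \<open>x = (1, - P\<^sup>-\<^sup>1 q)\<close> and \<open>z = (0, P\<^sup>-\<^sup>1 e\<^sub>i)\<close>; so \<open>\<kappa>\<close> is the
  Schur complement \<open>m - q\<^sup>T P\<^sup>-\<^sup>1 q\<close>, \<open>r = (P\<^sup>-\<^sup>1 q)\<^sub>i\<close> and \<open>p = (P\<^sup>-\<^sup>1)\<^sub>i\<^sub>i\<close>. The assumptions are
  the equations that characterise these objects and keep \<open>P\<^sup>-\<^sup>1\<close> itself out of sight.
\<close>

locale arrow_pencil =
  fixes M :: "'n::finite smat" and i :: 'n and a b d :: real
    and x z :: "real ^ 'n option" and \<kappa> r p :: real
  assumes pd: "pos_def M" and d_nz: "d \<noteq> 0"
    and Mx: "M *v x = \<kappa> *\<^sub>R axis None 1" and x0: "x $ None = 1" and xi: "x $ Some i = - r"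
    and Mz: "M *v z = axis (Some i) 1 + r *\<^sub>R axis None 1" and z0: "z $ None = 0"
    and zi: "z $ Some i = p"
    and \<kappa>_pos: "\<kappa> > 0" and p_pos: "p > 0"
begin

definition N :: "real \<Rightarrow> real \<Rightarrow> 'n smat" where
  "N s \<tau> = M - \<tau> *\<^sub>R A0 - s *\<^sub>R arrow i a b d"

definition \<rho> :: real where "\<rho> = r - b / d"

definition t :: "real \<Rightarrow> real" where "t s = 1 - s * d * p"

text \<open>The reciprocal of the entry at \<open>00\<close> of the inverse of \<open>N s 0\<close>; see \<open>matrix_inv_N\<close>.\<close>

definition \<phi> :: "real \<Rightarrow> real" where
  "\<phi> s = \<kappa> - s * (a - b\<^sup>2 / d) - s * d * \<rho>\<^sup>2 / t s"

text \<open>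
  The analogue of \<open>x\<close> for \<open>N s \<tau>\<close>: the multiple of \<open>z\<close> cancels the component of
  \<open>N s \<tau> *v x\<close> along the unit vector \<open>i\<close>.
\<close>

definition x' :: "real \<Rightarrow> real ^ 'n option" where
  "x' s = x - (s * d * \<rho> / t s) *\<^sub>R z"

lemma N_mult: "N s \<tau> *v v = M *v v
    - (\<tau> * v $ None + s * (a * v $ None + b * v $ Some i)) *\<^sub>R axis None 1
    - (s * (b * v $ None + d * v $ Some i)) *\<^sub>R axis (Some i) 1"
  unfolding N_def A0_arrow[of i]
  by (simp add: matrix_vector_mult_diff_rdistrib arrow_mult_vec
      algebra_simps flip: scaleR_matrix_vector_assoc)

lemma transpose_N: "transpose (N s \<tau>) = N s \<tau>"
proof -
  have "transpose M = M" using pd unfolding pos_def_def by blast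
  then show ?thesis
    unfolding N_def A0_arrow[of i] transpose_diff transpose_scaleR transpose_arrow by simp
qed

lemma N_z: "N s \<tau> *v z = t s *\<^sub>R axis (Some i) 1 + (\<rho> + b / d * t s) *\<^sub>R axis None 1"
proof -
  have "r - s * b * p = \<rho> + b / d * t s"
    using d_nz by (simp add: \<rho>_def t_def field_simps)
  moreover have "N s \<tau> *v z = t s *\<^sub>R axis (Some i) 1 + (r - s * b * p) *\<^sub>R axis None 1"
    unfolding N_mult Mz by (simp add: z0 zi t_def algebra_simps)
  ultimately show ?thesis by simp
qed

lemma N_x': 
  assumes "t s \<noteq> 0"
  shows "N s \<tau> *v x' s = (\<phi> s - \<tau>) *\<^sub>R axis None 1"
proof -
  have "N s \<tau> *v x = (\<kappa> - \<tau> - s * (a - b * r)) *\<^sub>R axis None 1 + (s * d * \<rho>) *\<^sub>R axis (Some i) 1"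
    unfolding N_mult Mx using d_nz by (simp add: x0 xi \<rho>_def algebra_simps)
  then have "N s \<tau> *v x' s = (\<kappa> - \<tau> - s * (a - b * r)
                 - s * d * \<rho> / t s * (\<rho> + b / d * t s)) *\<^sub>R axis None 1"
    using assms unfolding x'_def
    by (simp add: matrix_vector_mult_diff_distrib matrix_vector_mult_scaleR N_z
        scaleR_right_distrib scaleR_left_diff_distrib)
  moreover have "\<kappa> - \<tau> - s * (a - b * r) - s * d * \<rho> / t s * (\<rho> + b / d * t s) = \<phi> s - \<tau>"
  proof -
    have "s * d * \<rho> / t s * (\<rho> + b / d * t s) = s * d * \<rho>\<^sup>2 / t s + s * b * \<rho>"
      using assms d_nz by (simp add: field_simps power2_eq_square)
    moreover have "s * (a - b * r) + s * b * \<rho> = s * (a - b\<^sup>2 / d)"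
      using d_nz by (simp add: \<rho>_def field_simps power2_eq_square)
    ultimately show ?thesis unfolding \<phi>_def by argo
  qed
  ultimately show ?thesis by simp
qed

lemma x'_None: "x' s $ None = 1"
  by (simp add: x'_def x0 z0)

lemma x'_Some: "t s \<noteq> 0 \<Longrightarrow> x' s $ Some i = - (\<rho> + b / d * t s) / t s"
  using d_nz by (simp add: x'_def xi zi \<rho>_def t_def field_simps)

text \<open>
  A kernel vector is orthogonal to the images of \<open>x' s\<close> and \<open>z\<close>, which span the unit vectors \<open>0\<close>
  and \<open>i\<close>. On vectors that vanish at \<open>0\<close> and \<open>i\<close> the pencil does not differ from \<open>M\<close>.
\<close>

lemma invertible_N:
  assumes t: "t s \<noteq> 0" and \<tau>: "\<phi> s \<noteq> \<tau>"
  shows "invertible (N s \<tau>)"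
proof (rule invertible_if_trivial_kernel)
  fix v assume 0: "N s \<tau> *v v = 0"
  have sym: "v \<bullet> (N s \<tau> *v w) = 0" for w
    by (subst inner_symmetric_matrix[OF transpose_N]) (simp only: 0 inner_zero_right)
  have v0: "v $ None = 0"
    using sym[of "x' s"] \<tau> unfolding N_x'[OF t] by (simp add: inner_axis)
  moreover have "v $ Some i = 0"
    using sym[of z] t unfolding N_z by (simp add: inner_add_right inner_axis v0)
  ultimately have v: "v $ None = 0" "v $ Some i = 0" by auto
  then have "M *v v = 0" using 0 unfolding N_mult by simp
  then have "\<not> 0 < v \<bullet> (M *v v)" by simp
  then show "v = 0" using pd unfolding pos_def_def by blast
qed

text \<open>
  Suitable combinations of \<open>x' s\<close> and \<open>z\<close> are mapped to the unit vectors \<open>0\<close> and \<open>i\<close>, so they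
  are the corresponding columns of the inverse. Here \<open>q\<close> is the entry of \<open>x' s\<close> at \<open>i\<close>.
\<close>

lemma matrix_inv_N:
  assumes t: "t s \<noteq> 0" and \<tau>: "\<phi> s \<noteq> \<tau>"
  defines "W \<equiv> matrix_inv (N s \<tau>)" and "q \<equiv> - (\<rho> + b / d * t s) / t s"
  shows "W $ None $ None = 1 / (\<phi> s - \<tau>)"
    and "W $ Some i $ None = q / (\<phi> s - \<tau>)"
    and "W $ None $ Some i = q / (\<phi> s - \<tau>)"
    and "W $ Some i $ Some i = p / t s + q\<^sup>2 / (\<phi> s - \<tau>)"
proof -
  note inv = invertible_N[OF t \<tau>]
  have c0: "N s \<tau> *v ((1 / (\<phi> s - \<tau>)) *\<^sub>R x' s) = axis None 1"
    using \<tau> by (simp add: matrix_vector_mult_scaleR N_x'[OF t])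
  have Nz: "N s \<tau> *v z = t s *\<^sub>R axis (Some i) 1 - (t s * q) *\<^sub>R axis None 1"
  proof -
    have "\<rho> + b / d * t s = - (t s * q)" using t by (simp add: q_def)
    then show ?thesis unfolding N_z by simp
  qed
  have ci: "N s \<tau> *v ((1 / t s) *\<^sub>R z + (q / (\<phi> s - \<tau>)) *\<^sub>R x' s) = axis (Some i) 1"
    using \<tau> t
    by (simp add: matrix_vector_right_distrib matrix_vector_mult_scaleR N_x'[OF t] Nz
        scaleR_right_diff_distrib)
  show "W $ None $ None = 1 / (\<phi> s - \<tau>)" "W $ Some i $ None = q / (\<phi> s - \<tau>)"
    unfolding W_def matrix_inv_column[OF inv c0]
    by (simp_all add: x'_None x'_Some[OF t] q_def)
  show "W $ None $ Some i = q / (\<phi> s - \<tau>)" "W $ Some i $ Some i = p / t s + q\<^sup>2 / (\<phi> s - \<tau>)"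
    unfolding W_def matrix_inv_column[OF inv ci]
    by (simp_all add: x'_None x'_Some[OF t] q_def z0 zi power2_eq_square)
qed

text \<open>
  The vectors \<open>x' s\<close>, \<open>z\<close>, and any \<open>w\<close> that vanishes at \<open>0\<close> and \<open>i\<close> are mutually orthogonal for
  the quadratic form of \<open>N s \<tau>\<close>. Its values at the three are \<open>\<phi> s - \<tau>\<close>, \<open>t s * p\<close>, and the
  value at \<open>w\<close> of the form of \<open>M\<close>.
\<close>

lemma pos_semidef_N:
  assumes t: "t s > 0" and \<tau>: "\<tau> \<le> \<phi> s"
  shows "pos_semidef (N s \<tau>)"
  unfolding pos_semidef_def
proof (intro conjI allI)
  show "transpose (N s \<tau>) = N s \<tau>" by (rule transpose_N)
next
  fix v
  (* The coefficients are chosen so that the remainder w vanishes at 0 and i. *)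
  define c where "c = (v $ Some i - v $ None * x' s $ Some i) / p"
  define w where "w = v - v $ None *\<^sub>R x' s - c *\<^sub>R z"
  have w0: "w $ None = 0" "w $ Some i = 0"
    using p_pos by (simp_all add: w_def x'_None z0 zi c_def)
  have v: "v = v $ None *\<^sub>R x' s + c *\<^sub>R z + w" by (simp add: w_def)
  note sym = inner_symmetric_matrix[OF transpose_N[of s \<tau>]]
  note Nx' = N_x'[OF less_imp_neq[OF t, symmetric]]
  have B: "x' s \<bullet> (N s \<tau> *v x' s) = \<phi> s - \<tau>" "z \<bullet> (N s \<tau> *v x' s) = 0" "w \<bullet> (N s \<tau> *v x' s) = 0"
    "z \<bullet> (N s \<tau> *v z) = t s * p" "w \<bullet> (N s \<tau> *v z) = 0" "w \<bullet> (N s \<tau> *v w) = w \<bullet> (M *v w)"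
    unfolding Nx' N_z
    by (simp_all add: inner_axis inner_add_right x'_None z0 zi w0 N_mult)
  have B': "x' s \<bullet> (N s \<tau> *v z) = 0" "x' s \<bullet> (N s \<tau> *v w) = 0" "z \<bullet> (N s \<tau> *v w) = 0"
    using B sym[of "x' s" z] sym[of "x' s" w] sym[of z w] by simp_all
  have "(\<alpha> *\<^sub>R x' s + c *\<^sub>R z + w) \<bullet> (N s \<tau> *v (\<alpha> *\<^sub>R x' s + c *\<^sub>R z + w))
      = (\<phi> s - \<tau>) * \<alpha>\<^sup>2 + t s * p * c\<^sup>2 + w \<bullet> (M *v w)" for \<alpha>
    unfolding matrix_vector_right_distrib matrix_vector_mult_scaleR
      inner_add_left inner_add_right inner_scaleR_left inner_scaleR_right B B'
    by (simp add: power2_eq_square)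
  from this[of "v $ None"]
  have "v \<bullet> (N s \<tau> *v v) = (\<phi> s - \<tau>) * (v $ None)\<^sup>2 + t s * p * c\<^sup>2 + w \<bullet> (M *v w)"
    unfolding v[symmetric] .
  moreover have "w \<bullet> (M *v w) \<ge> 0"
  proof (cases "w = 0")
    case False
    then show ?thesis using pd unfolding pos_def_def by (blast intro: less_imp_le)
  qed simp
  moreover have "(\<phi> s - \<tau>) * (v $ None)\<^sup>2 \<ge> 0" "t s * p * c\<^sup>2 \<ge> 0"
    using t \<tau> p_pos by simp_all
  ultimately show "0 \<le> v \<bullet> (N s \<tau> *v v)" by linarith
qed

lemma open_t: "open {s. t s \<noteq> 0}"
  unfolding t_def by (intro open_Collect_neq continuous_intros)

lemma \<phi>_deriv:
  assumes "t s \<noteq> 0"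
  shows "(\<phi> has_real_derivative - (a - b\<^sup>2 / d) - d * \<rho>\<^sup>2 / (t s)\<^sup>2) (at s)"
proof -
  have "((\<lambda>s. \<kappa> - s * (a - b\<^sup>2 / d) - s * d * \<rho>\<^sup>2 / t s) has_real_derivative
      - (a - b\<^sup>2 / d) - (d * \<rho>\<^sup>2 * t s + s * d * \<rho>\<^sup>2 * (d * p)) / (t s * t s)) (at s)"
    using assms unfolding t_def by (auto intro!: derivative_eq_intros)
  (* The numerator left by the quotient rule does not depend on s. *)
  moreover have "d * \<rho>\<^sup>2 * t s + s * d * \<rho>\<^sup>2 * (d * p) = d * \<rho>\<^sup>2"
    unfolding t_def by (simp add: algebra_simps)
  ultimately show ?thesis unfolding \<phi>_def[abs_def] by (simp add: power2_eq_square)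
qed

text \<open>
  Where \<open>\<phi>\<close> vanishes the matrix \<open>N s 0\<close> is singular and \<^const>\<open>s0_expr\<close> is a junk value. These
  points are isolated because \<open>\<phi> * t\<close> is a polynomial with the nonzero constant term \<open>\<kappa>\<close>.
\<close>

lemma eventually_\<phi>_nonzero:
  assumes "t s \<noteq> 0"
  shows "\<forall>\<^sub>F s' in at s. t s' \<noteq> 0 \<and> \<phi> s' \<noteq> 0"
proof -
  define c where "c = a - b\<^sup>2 / d"
  define P where "P = [:\<kappa>, - (\<kappa> * d * p + c + d * \<rho>\<^sup>2), c * d * p:]"
  have "P \<noteq> 0" using \<kappa>_pos by (simp add: P_def)
  then have fin: "finite {s'. poly P s' = 0}" by (rule poly_roots_finite)
  have P: "poly P s' = \<phi> s' * t s'" if "t s' \<noteq> 0" for s'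
  proof -
    have "\<phi> s' * t s' = (\<kappa> - s' * c) * t s' - s' * d * \<rho>\<^sup>2"
      using that unfolding \<phi>_def c_def[symmetric] by (simp add: left_diff_distrib)
    then show ?thesis unfolding P_def t_def by (simp add: algebra_simps)
  qed
  have "\<forall>\<^sub>F s' in at s. poly P s' \<noteq> 0"
    using fin islimpt_finite[OF fin, of s] by (simp add: islimpt_iff_eventually)
  moreover have "\<forall>\<^sub>F s' in at s. t s' \<noteq> 0"
    using open_t assms eventually_at_topological by blast
  ultimately show ?thesis
    by eventually_elim (auto simp: P)
qed

end

text \<open>
  The vectors \<open>x\<close> and \<open>z\<close> are the column \<open>0\<close> of the inverse of \<open>M\<close>, scaled to have the entry \<open>1\<close>
  at \<open>0\<close>, and its column \<open>i\<close>, corrected by a multiple of column \<open>0\<close> to vanish at \<open>0\<close>.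
\<close>

lemma arrow_pencil_exists:
  fixes M :: "'n::finite smat"
  assumes pd: "pos_def M" and d: "d \<noteq> 0"
  obtains x z \<kappa> r p where "arrow_pencil M i d x z \<kappa> r p"
proof -
  from pos_def_invertible[OF pd] obtain M' where M': "M ** M' = mat 1"
    unfolding invertible_def by blast
  define \<omega> where "\<omega> = M' *v axis None 1"
  define \<zeta> where "\<zeta> = M' *v axis (Some i) 1"
  have M\<omega>: "M *v \<omega> = axis None 1" and M\<zeta>: "M *v \<zeta> = axis (Some i) 1"
    by (simp_all add: \<omega>_def \<zeta>_def matrix_vector_mul_assoc M')
  have pos: "0 < v \<bullet> (M *v v)" if "M *v v \<noteq> 0" for v
    using pd that unfolding pos_def_def by (metis matrix_vector_mult_0_right)
  have sym: "v \<bullet> (M *v w) = w \<bullet> (M *v v)" for v w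
    using pd inner_symmetric_matrix unfolding pos_def_def by blast
  have \<omega>0: "\<omega> $ None > 0"
    using pos[of \<omega>] by (simp add: M\<omega> inner_axis)
  have \<zeta>0: "\<zeta> $ None = \<omega> $ Some i"
    using sym[of \<zeta> \<omega>] by (simp add: M\<omega> M\<zeta> inner_axis)
  define \<kappa> where "\<kappa> = 1 / \<omega> $ None"
  define r where "r = - (\<kappa> * \<omega> $ Some i)"
  define z where "z = \<zeta> + r *\<^sub>R \<omega>"
  have Mz: "M *v z = axis (Some i) 1 + r *\<^sub>R axis None 1"
    by (simp add: z_def matrix_vector_right_distrib matrix_vector_mult_scaleR M\<omega> M\<zeta>)
  have z0: "z $ None = 0" using \<omega>0 by (simp add: z_def \<zeta>0 r_def \<kappa>_def)
  have "(M *v z) $ Some i \<noteq> 0" by (simp add: Mz axis_def)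
  then have "0 < z \<bullet> (M *v z)" using pos by (metis zero_index)
  then have "z $ Some i > 0" by (simp add: Mz inner_axis inner_add_right z0)
  then have "arrow_pencil M i d (\<kappa> *\<^sub>R \<omega>) z \<kappa> r (z $ Some i)"
    using pd d \<omega>0 Mz z0
    by unfold_locales (auto simp: matrix_vector_mult_scaleR M\<omega> \<kappa>_def r_def)
  then show thesis by (rule that)
qed


section \<open>Filled-in functions, the moved point, and the sign of the slope\<close>

lemma filled_eqI:
  assumes "\<forall>\<^sub>F s' in at s. h s' = f s'" and "isCont f s"
  shows "s \<in> filled_dom h" and "filled h s = f s"
proof -
  have "(h \<longlongrightarrow> f s) (at s)"
    using assms tendsto_cong[OF assms(1)] by (simp add: isCont_def)
  then show "s \<in> filled_dom h" "filled h s = f s"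
    unfolding filled_dom_def filled_def by (auto intro: tendsto_Lim)
qed

lemma unit_vec_None:
  "unit_vec None (Some c) = 0" "unit_vec (Some c) None = 0" "unit_vec None None = 1"
  by (simp_all add: unit_vec_def)

lemma slack_moved_point:
  assumes "l i \<le> j" "j \<le> u i"
  shows "slack Q l u \<beta> (moved_point Q l u \<beta> \<sigma> y i j s)
       = slack Q l u \<beta> y - s0 Q l u \<beta> \<sigma> y i j s *\<^sub>R A0 - s *\<^sub>R Amat l u \<beta> i j"
proof -
  have "(\<Sum>k\<in>UNIV. \<Sum>m\<in>{l k..u k}.
           (s * unit_vec (Some (i, j)) (Some (k, m))) *\<^sub>R Amat l u \<beta> k m)
      = (\<Sum>k\<in>UNIV. \<Sum>m\<in>{l k..u k}. if k = i \<and> m = j then s *\<^sub>R Amat l u \<beta> i j else 0)"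
    by (intro sum.cong refl) (simp add: unit_vec_def)
  also have "\<dots> = (\<Sum>k\<in>UNIV. if k = i then s *\<^sub>R Amat l u \<beta> i j else 0)"
    using assms by (intro sum.cong refl) auto
  also have "\<dots> = s *\<^sub>R Amat l u \<beta> i j" by simp
  finally have sum: "(\<Sum>k\<in>UNIV. \<Sum>m\<in>{l k..u k}.
           (s * unit_vec (Some (i, j)) (Some (k, m))) *\<^sub>R Amat l u \<beta> k m)
      = s *\<^sub>R Amat l u \<beta> i j" .
  show ?thesis
    unfolding slack_def adjoint_map_def moved_point_def
    by (simp add: scaleR_left_distrib sum.distrib sum unit_vec_None)
qed

lemma nonpos_coords_moved_point:
  assumes "nonpos_coords l u y" and "y (Some (i, j)) + s \<le> 0"
  shows "nonpos_coords l u (moved_point Q l u \<beta> \<sigma> y i j s)"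
  using assms unfolding nonpos_coords_def moved_point_def
  by (auto simp: unit_vec_def)

text \<open>
  After multiplication by \<open>t\<^sup>2\<close> this is the quadratic \<open>G t\<^sup>2 - c t - e\<close>, whose roots have the
  product \<open>- e / G \<le> 0\<close> and the positive sum \<open>c / G\<close>. So exactly one root \<open>T\<close> is positive, and
  the other one, \<open>- e / (G T)\<close>, does not affect the sign for \<open>t > 0\<close>.
\<close>

lemma barrier_slope_sign:
  fixes G c e :: real
  assumes G: "G > 0" and c: "c > 0" and e: "e \<ge> 0"
  obtains T where "T > 0" and "\<And>t. t > 0 \<Longrightarrow> sgn (G - e / t\<^sup>2 - c / t) = sgn (t - T)"
proof -
  define T where "T = (c + sqrt (c\<^sup>2 + 4 * G * e)) / (2 * G)"
  have root: "0 \<le> c\<^sup>2 + 4 * G * e" using G e by simp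
  have T: "T > 0" using G c root unfolding T_def by (simp add: add_pos_nonneg)
  have "(2 * G * T - c)\<^sup>2 = c\<^sup>2 + 4 * G * e" using G root by (simp add: T_def)
  then have "4 * G * (G * T\<^sup>2 - c * T - e) = 0" by (simp add: power2_eq_square algebra_simps)
  then have quad: "G * T\<^sup>2 - c * T - e = 0" using G by simp
  have "sgn (G - e / t\<^sup>2 - c / t) = sgn (t - T)" if t: "t > 0" for t
  proof -
    have "G - e / t\<^sup>2 - c / t = (t - T) * ((G * t + e / T) / t\<^sup>2)"
    proof -
      have "(t - T) * (G * t + e / T) = G * t\<^sup>2 - t * ((G * T\<^sup>2 - e) / T) - e"
        using T by (simp add: field_simps power2_eq_square)
      also have "G * T\<^sup>2 - e = c * T" using quad by simp
      finally have "(t - T) * (G * t + e / T) = G * t\<^sup>2 - t * c - e" using T by simp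
      moreover have "G - e / t\<^sup>2 - c / t = (G * t\<^sup>2 - t * c - e) / t\<^sup>2"
        using t by (simp add: field_simps power2_eq_square)
      ultimately show ?thesis by simp
    qed
    moreover have "(G * t + e / T) / t\<^sup>2 > 0"
      using t T G e by (simp add: add_pos_nonneg)
    ultimately show ?thesis by (simp only: sgn_mult sgn_pos mult_1_right)
  qed
  with T show thesis by (rule that)
qed

section \<open>A step along one coordinate\<close>

text \<open>
  The assumption \<open>discriminant\<close> says that the quadratic \<open>d X\<^sup>2 + 2 b X + a - \<beta> i j\<close> has two distinct
  real roots.
\<close>

locale coordinate_step =
  arrow_pencil "slack Q l u \<beta> y" i a b d x z \<kappa> r p
  for Q :: "'n::finite smat" and l u \<beta> y i a b d x z \<kappa> r p +
  fixes j :: int and \<sigma> :: real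
  assumes \<sigma>_pos: "\<sigma> > 0" and j: "l i \<le> j" "j \<le> u i"
    and Amat: "Amat l u \<beta> i j = arrow i a b d"
    and discriminant: "b\<^sup>2 > d * (a - \<beta> i j)"
begin

lemma s0_filled:
  assumes "t s \<noteq> 0"
  shows "s \<in> s0_dom Q l u \<beta> \<sigma> y i j" and "s0 Q l u \<beta> \<sigma> y i j s = \<phi> s - \<sigma>"
proof -
  have "s0_expr Q l u \<beta> \<sigma> y i j s' = \<phi> s' - \<sigma>" if "t s' \<noteq> 0" "\<phi> s' \<noteq> 0" for s'
    using matrix_inv_N(1)[of s' 0] that
    by (simp add: s0_expr_def Wmat_def N_def Amat)
  then have ev: "\<forall>\<^sub>F s' in at s. s0_expr Q l u \<beta> \<sigma> y i j s' = \<phi> s' - \<sigma>"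
    using eventually_\<phi>_nonzero[OF assms] by (auto elim: eventually_mono)
  have "isCont (\<lambda>s. \<phi> s - \<sigma>) s"
    using DERIV_isCont[OF \<phi>_deriv[OF assms]] by (intro continuous_intros)
  from filled_eqI[OF ev this]
  show "s \<in> s0_dom Q l u \<beta> \<sigma> y i j" "s0 Q l u \<beta> \<sigma> y i j s = \<phi> s - \<sigma>"
    by (simp_all add: s0_dom_def s0_def)
qed

text \<open>The closed form of \<open>g'\<^sub>i\<^sub>j\<close> away from the zero of \<open>t\<close>.\<close>

definition slope :: "real \<Rightarrow> real" where
  "slope s = \<beta> i j - a + b\<^sup>2 / d - d * \<rho>\<^sup>2 / (t s)\<^sup>2 - \<sigma> * (d * p / t s)"

text \<open>
  The Schur complement of the moved slack matrix is the constant \<open>\<sigma>\<close>. Therefore the terms of the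
  trace that carry the factor \<open>1 / \<sigma>\<close>, which form the logarithmic derivative of this Schur
  complement up to sign, cancel, and only the logarithmic derivative \<open>- d p / t\<close> of \<open>t\<close> remains, again
  up to sign.
\<close>

lemma dg_expr_eq:
  assumes t: "t s \<noteq> 0"
  shows "dg_expr Q l u \<beta> \<sigma> y i j s = slope s"
proof -
  define \<phi>' where "\<phi>' = - (a - b\<^sup>2 / d) - d * \<rho>\<^sup>2 / (t s)\<^sup>2"
  have "((\<lambda>s. \<phi> s - \<sigma>) has_real_derivative \<phi>') (at s)"
    using \<phi>_deriv[OF t] unfolding \<phi>'_def by (auto intro!: derivative_eq_intros)
  moreover have "\<forall>\<^sub>F s' in nhds s. t s' \<noteq> 0"
    using open_t t eventually_nhds by blast
  then have "\<forall>\<^sub>F s' in nhds s. s0 Q l u \<beta> \<sigma> y i j s' = \<phi> s' - \<sigma>"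
    by eventually_elim (rule s0_filled)
  ultimately have "(s0 Q l u \<beta> \<sigma> y i j has_real_derivative \<phi>') (at s)"
    by (subst DERIV_cong_ev[OF refl _ refl])
  then have deriv: "deriv (s0 Q l u \<beta> \<sigma> y i j) s = \<phi>'" by (rule DERIV_imp_deriv)
  define q where "q = - (\<rho> + b / d * t s) / t s"
  have "\<phi> s \<noteq> \<phi> s - \<sigma>" using \<sigma>_pos by simp
  note W = matrix_inv_N[OF t this, folded q_def]
  have "(\<phi>' *\<^sub>R A0 + arrow i a b d) \<bullet> matrix_inv (N s (\<phi> s - \<sigma>))
      = (\<phi>' + a + 2 * b * q + d * q\<^sup>2) / \<sigma> + d * p / t s"
    unfolding scaleR_A0_plus_arrow arrow_inner W using \<sigma>_pos t by (simp add: field_simps)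
  also have "\<phi>' + a + 2 * b * q + d * q\<^sup>2 = 0"
  proof -
    have "q + b / d = - (\<rho> / t s)" using t d_nz by (simp add: q_def field_simps)
    moreover have "b\<^sup>2 / d + 2 * b * q + d * q\<^sup>2 = d * (q + b / d)\<^sup>2"
      using d_nz by (simp add: power2_eq_square field_simps)
    ultimately show ?thesis unfolding \<phi>'_def by (simp add: power_divide)
  qed
  finally have "(\<phi>' *\<^sub>R A0 + arrow i a b d) \<bullet> matrix_inv (N s (\<phi> s - \<sigma>)) = d * p / t s"
    by simp
  then show ?thesis
    unfolding dg_expr_def deriv s0_filled(2)[OF t] Amat
    by (simp add: N_def slope_def \<phi>'_def)
qed

lemma dg_filled:
  assumes t: "t s \<noteq> 0"
  shows "s \<in> dg_dom Q l u \<beta> \<sigma> y i j" and "dg Q l u \<beta> \<sigma> y i j s = slope s"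
proof -
  have "\<forall>\<^sub>F s' in at s. t s' \<noteq> 0"
    using open_t t eventually_at_topological by blast
  then have ev: "\<forall>\<^sub>F s' in at s. dg_expr Q l u \<beta> \<sigma> y i j s' = slope s'"
    by eventually_elim (rule dg_expr_eq)
  have "isCont slope s"
    using t unfolding slope_def[abs_def] t_def by (intro continuous_intros) auto
  from filled_eqI[OF ev this]
  show "s \<in> dg_dom Q l u \<beta> \<sigma> y i j" "dg Q l u \<beta> \<sigma> y i j s = slope s"
    by (simp_all add: dg_dom_def dg_def)
qed

text \<open>
  In terms of \<open>t\<close> the slope is \<open>d\<close> times an expression that changes its sign from negative to
  positive. The map from \<open>s\<close> to \<open>t\<close> has the derivative \<open>- d p\<close>, so in terms of \<open>s\<close> the slope changes
  from positive to negative for either sign of \<open>d\<close>.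
\<close>

lemma slope_sign:
  obtains S where "t S > 0" and "\<And>s. t s > 0 \<Longrightarrow> sgn (slope s) = sgn (S - s)"
proof -
  define G where "G = (b\<^sup>2 - d * (a - \<beta> i j)) / d\<^sup>2"
  have "G > 0" "\<sigma> * p > 0" "\<rho>\<^sup>2 \<ge> 0"
    using discriminant d_nz \<sigma>_pos p_pos by (simp_all add: G_def)
  then obtain T where T: "T > 0"
    "\<And>t. t > 0 \<Longrightarrow> sgn (G - \<rho>\<^sup>2 / t\<^sup>2 - \<sigma> * p / t) = sgn (t - T)"
    using barrier_slope_sign by blast
  define S where "S = (1 - T) / (d * p)"
  have tS: "t S = T" using d_nz p_pos by (simp add: S_def t_def)
  have slope: "slope s = d * (G - \<rho>\<^sup>2 / (t s)\<^sup>2 - \<sigma> * p / t s)" for s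
    using d_nz by (simp add: slope_def G_def right_diff_distrib power2_eq_square diff_divide_distrib)
  have "sgn (slope s) = sgn (S - s)" if "t s > 0" for s
  proof -
    have "t s - T = d * p * (S - s)"
      using tS unfolding t_def by (simp add: algebra_simps)
    then have "sgn (slope s) = sgn (d * d * p * (S - s))"
      unfolding slope sgn_mult T(2)[OF that] by (simp add: sgn_mult)
    also have "\<dots> = sgn (S - s)"
      using d_nz p_pos by (simp add: sgn_mult)
    finally show ?thesis .
  qed
  with T(1) tS show thesis by (intro that) auto
qed

lemma dual_feasible_moved_point:
  assumes "t s > 0" and "nonpos_coords l u y" and "y (Some (i, j)) + s \<le> 0"
  shows "dual_feasible Q l u \<beta> (moved_point Q l u \<beta> \<sigma> y i j s)"
  unfolding dual_feasible_def slack_moved_point[where l = l and u = u, OF j] Amat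
  using pos_semidef_N[OF assms(1), of "\<phi> s - \<sigma>"] \<sigma>_pos s0_filled(2)[of s] assms
    nonpos_coords_moved_point[OF assms(2,3)]
  by (simp add: N_def)

lemma t_interval:
  assumes "t s1 > 0" "t s2 > 0" "s1 \<le> s" "s \<le> s2"
  shows "t s > 0"
proof (cases "d > 0")
  case True
  then have "s * (d * p) \<le> s2 * (d * p)" using assms p_pos by (intro mult_right_mono) auto
  then show ?thesis using assms by (simp add: t_def mult.assoc)
next
  case False
  then have "s * (d * p) \<le> s1 * (d * p)"
    using assms p_pos by (intro mult_right_mono_neg) (auto simp: mult_nonpos_nonneg)
  then show ?thesis using assms by (simp add: t_def mult.assoc)
qed

lemma t_0: "t 0 > 0"
  by (simp add: t_def)

text \<open>
  The sign is only claimed between \<open>0\<close> and \<open>S\<close>. This interval lies in the region \<open>t > 0\<close>; beyond the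
  zero of \<open>t\<close> there can be a second root, for which the moved slack matrix is indefinite, but it is
  farther from \<open>0\<close> than \<open>S\<close> whenever it lies on the same side.
\<close>

lemma critical_point:
  assumes "nonpos_coords l u y"
  obtains S where
    "S \<in> dg_roots Q l u \<beta> \<sigma> y i j" and "S \<in> s0_dom Q l u \<beta> \<sigma> y i j"
    and "\<forall>s\<in>{min 0 S..max 0 S}. s \<in> dg_dom Q l u \<beta> \<sigma> y i j"
    and "\<forall>s\<in>{min 0 S..max 0 S}. sgn (dg Q l u \<beta> \<sigma> y i j s) = sgn (S - s)"
    and "y (Some (i, j)) + S \<le> 0 \<longrightarrow>
           dual_feasible Q l u \<beta> (moved_point Q l u \<beta> \<sigma> y i j S)"
proof -
  from slope_sign obtain S where S: "t S > 0"
    and sgn: "\<And>s. t s > 0 \<Longrightarrow> sgn (slope s) = sgn (S - s)" by blast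
  have ts: "t s > 0" if "s \<in> {min 0 S..max 0 S}" for s
    using that S t_0 t_interval[of "min 0 S" "max 0 S" s] by (simp add: min_def max_def split: if_splits)
  show thesis
  proof (rule that[of S])
    show "S \<in> dg_roots Q l u \<beta> \<sigma> y i j"
      using S sgn[OF S] dg_filled[of S] by (simp add: dg_roots_def sgn_zero_iff)
    show "S \<in> s0_dom Q l u \<beta> \<sigma> y i j" using S s0_filled[of S] by simp
    show "\<forall>s\<in>{min 0 S..max 0 S}. s \<in> dg_dom Q l u \<beta> \<sigma> y i j"
      using ts dg_filled(1) by (metis less_irrefl)
    show "\<forall>s\<in>{min 0 S..max 0 S}. sgn (dg Q l u \<beta> \<sigma> y i j s) = sgn (S - s)"
      using ts dg_filled(2) sgn by (metis less_irrefl)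
    show "y (Some (i, j)) + S \<le> 0 \<longrightarrow>
           dual_feasible Q l u \<beta> (moved_point Q l u \<beta> \<sigma> y i j S)"
      using dual_feasible_moved_point[OF S assms] by blast
  qed
qed

end

text \<open>
  The discriminant condition is where \<open>l\<^sub>i \<noteq> u\<^sub>i\<close> enters. For \<open>j = u\<^sub>i\<close> the quadratic has the roots
  \<open>l\<^sub>i\<close> and \<open>u\<^sub>i\<close>; for \<open>j < u\<^sub>i\<close> it has the roots \<open>j\<close> and \<open>j + 1\<close>.
\<close>

lemma coordinate_step_exists:
  fixes Q :: "'n::finite smat"
  assumes "\<sigma> > 0" and "pos_def (slack Q l u \<beta> y)" and lu: "l i < u i" and "l i \<le> j" "j \<le> u i"
  obtains a b d x z \<kappa> r p where "coordinate_step Q l u \<beta> y i a b d x z \<kappa> r p j \<sigma>"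
proof -
  obtain a b d where A: "Amat l u \<beta> i j = arrow i a b d" and d: "d \<noteq> 0"
    and disc: "b\<^sup>2 > d * (a - \<beta> i j)"
  proof (cases "j = u i")
    case True
    have "(real_of_int (u i) - real_of_int (l i))\<^sup>2 > 0" using lu by simp
    then have "(- (real_of_int (l i + u i) / 2))\<^sup>2 > real_of_int (l i * u i)"
      by (simp add: power2_eq_square field_simps)
    with True show thesis
      by (intro that[of "\<beta> i j + real_of_int (l i * u i)" "- (real_of_int (l i + u i) / 2)" 1])
        (simp_all add: Amat_def)
  next
    case False
    then show thesis
      by (intro that[of "\<beta> i j - real_of_int (j * (j + 1))" "real_of_int j + 1 / 2" "- 1"])
        (simp_all add: Amat_def power2_eq_square algebra_simps)
  qed
  obtain x z \<kappa> r p where "arrow_pencil (slack Q l u \<beta> y) i d x z \<kappa> r p"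
    by (rule arrow_pencil_exists[OF assms(2) d])
  then have "coordinate_step Q l u \<beta> y i a b d x z \<kappa> r p j \<sigma>"
    using assms A disc by (simp add: coordinate_step_def coordinate_step_axioms_def)
  then show thesis by (rule that)
qed

section \<open>The first critical point of a coordinate step\<close>

text \<open>
  The root required in either part is the critical point \<open>S\<close> in the region of positive definite
  slack. In part (i), if \<open>S\<close> would move the coordinate beyond \<open>0\<close>, then \<open>- y\<^sub>i\<^sub>j\<close> lies between \<open>0\<close>
  and \<open>S\<close>, where the slope is still positive; in part (ii) the coordinate decreases and stays
  nonpositive.
\<close>

theorem theorem11:
  fixes Qh :: "real ^ 'n ^ 'n" and lh :: "real ^ 'n" and ch :: real
    and l u :: "'n::finite \<Rightarrow> int" and \<beta> :: "'n \<Rightarrow> int \<Rightarrow> real"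
    and \<sigma> :: real and y :: "'n dvec" and i :: 'n and j :: int
    and Q :: "'n smat"
  assumes "transpose Qh = Qh"
    and "\<forall>k. l k < u k"
    and "Q = Qmat ch lh Qh"
    and "\<sigma> > 0"
    and "pos_def (slack Q l u \<beta> y)"
    and "nonpos_coords l u y"
    and "l i \<le> j" and "j \<le> u i"
  shows
    "let g' = dg Q l u \<beta> \<sigma> y i j;
         D = dg_dom Q l u \<beta> \<sigma> y i j;
         R = dg_roots Q l u \<beta> \<sigma> y i j;
         D0 = s0_dom Q l u \<beta> \<sigma> y i j;
         pt = moved_point Q l u \<beta> \<sigma> y i j;
         yij = y (Some (i, j))
     in
       (g' 0 > 0 \<and> yij < 0 \<longrightarrow>
          ((\<exists>s\<in>R. s > 0) \<longrightarrow>
             (\<exists>sp\<in>R. sp > 0 \<and> (\<forall>s\<in>R. s > 0 \<longrightarrow> sp \<le> s) \<and>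
                ((sp \<in> D0 \<and> dual_feasible Q l u \<beta> (pt sp) \<and> g' sp = 0) \<or>
                 (yij + sp > 0 \<and> - yij \<in> D \<and> g' (- yij) > 0)))) \<and>
          (\<not> (\<exists>s\<in>R. s > 0) \<longrightarrow> - yij \<in> D \<and> g' (- yij) > 0))
       \<and>
       (g' 0 < 0 \<longrightarrow>
          (\<exists>s\<in>R. s < 0) \<and>
          (\<exists>sm\<in>R. sm < 0 \<and> (\<forall>s\<in>R. s < 0 \<longrightarrow> s \<le> sm) \<and>
             sm \<in> D0 \<and> dual_feasible Q l u \<beta> (pt sm) \<and> g' sm = 0))"
proof -
  have lu: "l i < u i" using assms(2) by blast
  obtain a b d x z \<kappa> r p where "coordinate_step Q l u \<beta> y i a b d x z \<kappa> r p j \<sigma>"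
    by (rule coordinate_step_exists[OF assms(4,5) lu assms(7,8)])
  then interpret coordinate_step Q l u \<beta> y i a b d x z \<kappa> r p j \<sigma> .
  define g' where "g' = dg Q l u \<beta> \<sigma> y i j"
  define D where "D = dg_dom Q l u \<beta> \<sigma> y i j"
  define R where "R = dg_roots Q l u \<beta> \<sigma> y i j"
  define D0 where "D0 = s0_dom Q l u \<beta> \<sigma> y i j"
  define pt where "pt = moved_point Q l u \<beta> \<sigma> y i j"
  define yij where "yij = y (Some (i, j))"
  obtain S where SR: "S \<in> R" and SD0: "S \<in> D0"
    and inD: "\<forall>s\<in>{min 0 S..max 0 S}. s \<in> D"
    and sgn: "\<forall>s\<in>{min 0 S..max 0 S}. sgn (g' s) = sgn (S - s)"
    and feas: "yij + S \<le> 0 \<longrightarrow> dual_feasible Q l u \<beta> (pt S)"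
    unfolding g'_def D_def R_def D0_def pt_def yij_def
    by (rule critical_point[OF assms(6)])
  have gS: "g' S = 0" and gR: "\<And>s. s \<in> R \<Longrightarrow> g' s = 0"
    using SR by (simp_all add: R_def g'_def dg_roots_def)
  have yij: "yij \<le> 0" using assms(6-8) by (simp add: nonpos_coords_def yij_def)
  have sgn0: "sgn (g' 0) = sgn S" using bspec[OF sgn, of 0] by simp
  have only: "s = S" if "s \<in> R" "s \<in> {min 0 S..max 0 S}" for s
    using bspec[OF sgn that(2)] gR[OF that(1)] by (simp add: sgn_if split: if_splits)
  have i: "\<exists>sp\<in>R. sp > 0 \<and> (\<forall>s\<in>R. s > 0 \<longrightarrow> sp \<le> s) \<and>
                ((sp \<in> D0 \<and> dual_feasible Q l u \<beta> (pt sp) \<and> g' sp = 0) \<or>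
                 (yij + sp > 0 \<and> - yij \<in> D \<and> g' (- yij) > 0))"
    if "g' 0 > 0" "yij < 0"
  proof (intro bexI[of _ S] conjI ballI impI)
    show S: "S > 0" using sgn0 that by (metis sgn_1_pos)
    show "S \<le> s" if "s \<in> R" "s > 0" for s
      using only[OF that(1)] that S by (cases "s \<le> S") auto
    show "(S \<in> D0 \<and> dual_feasible Q l u \<beta> (pt S) \<and> g' S = 0) \<or>
          (yij + S > 0 \<and> - yij \<in> D \<and> g' (- yij) > 0)"
    proof (cases "yij + S \<le> 0")
      case True
      then show ?thesis using SD0 gS feas by blast
    next
      case False
      then have m: "- yij \<in> {min 0 S..max 0 S}" using that S by auto
      have "sgn (g' (- yij)) = 1" using bspec[OF sgn m] False by simp
      then show ?thesis using bspec[OF inD m] False by (simp add: sgn_1_pos)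
    qed
  qed (rule SR)
  have ii: "\<exists>sm\<in>R. sm < 0 \<and> (\<forall>s\<in>R. s < 0 \<longrightarrow> s \<le> sm) \<and>
             sm \<in> D0 \<and> dual_feasible Q l u \<beta> (pt sm) \<and> g' sm = 0" if "g' 0 < 0"
  proof (intro bexI[of _ S] conjI ballI impI)
    show S: "S < 0" using sgn0 that by (metis sgn_1_neg)
    show "s \<le> S" if "s \<in> R" "s < 0" for s
      using only[OF that(1)] that S by (cases "S \<le> s") auto
    show "dual_feasible Q l u \<beta> (pt S)" using feas S yij by simp
  qed (rule SR SD0 gS)+
  show ?thesis
    unfolding Let_def g'_def[symmetric] D_def[symmetric] R_def[symmetric] D0_def[symmetric]
      pt_def[symmetric] yij_def[symmetric]
    using i ii by blast
qed

end
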